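(* Let $\mathcal{P}$ be the distributive lattice of order ideals (ordered by inclusion) of a finite poset of width two. Then $\dim A_T(\mathcal{P})=\dim I_T(\mathcal{P})=\mathrm{rk}(\mathcal{P})+1$.
   Context: The width of a finite poset is the maximum cardinality of an antichain; the rank $\mathrm{rk}(\mathcal{P})$ is one less than the maximal cardinality of a chain. For a finite poset $\mathcal{P}$, $\mathcal{J}(\mathcal{P})$ is the set of order ideals (down-closed subsets) of $\mathcal{P}$. For $p\in\mathcal{P}$ define real-valued functions on $\mathcal{J}(\mathcal{P})$: $\mathbf{1}_p(I)=1$ if $p\in I$ and $0$ otherwise; $\mathcal{T}_p^-(I)=1$ if $p$ is a maximal element of $I$ and $0$ otherwise; $\mathcal{T}_p^+(I)=1$ if $p\notin I$ and $I\cup\{p\}\in\mathcal{J}(\mathcal{P})$, and $0$ otherwise; $\mathcal{T}_p=\mathcal{T}_p^+-\mathcal{T}_p^-$. The toggleability spaces are the real vector spaces $I_T(\mathcal{P})=\mathrm{Span}_{\mathbb{R}}(\mathbf{1}_p\mid p\in\mathcal{P})\cap\mathrm{Span}_{\mathbb{R}}(\{1\}\cup\{\mathcal{T}_p\mid p\in\mathcal{P}\})$ and $A_T(\mathcal{P})=\mathrm{Span}_{\mathbb{R}}(\mathcal{T}_p^-\mid p\in\mathcal{P})\cap\mathrm{Span}_{\mathbb{R}}(\{1\}\cup\{\mathcal{T}_p\mid p\in\mathcal{P}\})$, where $1$ is the constant function. (Here these are applied to the poset $\mathcal{P}$ itself, which is a lattice of order ideals of another poset.) *)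

theory Defs
  imports Complex_Main "HOL-Library.Function_Algebras" "HOL-Library.Indicator_Function"
begin

text \<open>
  A finite poset is a finite set \<open>P\<close> of elements of an ordered type, with the induced order. This
  covers all finite posets up to isomorphism: a poset on a type \<open>'b\<close> embeds into \<open>'b set\<close>, ordered
  by inclusion, through its principal ideals.
\<close>

definition antichain :: "'a::order set \<Rightarrow> bool" where
  "antichain A \<longleftrightarrow> (\<forall>x\<in>A. \<forall>y\<in>A. x \<le> y \<longrightarrow> x = y)"

definition width :: "'a::order set \<Rightarrow> nat" where
  "width P = Max (card ` {A. A \<subseteq> P \<and> antichain A})"

text \<open>The subtraction truncates only for \<open>P = {}\<close>; a lattice of order ideals is never empty.\<close>

definition rk :: "'a::order set \<Rightarrow> nat" where
  "rk P = Max (card ` {C. C \<subseteq> P \<and> Complete_Partial_Order.chain (\<le>) C}) - 1"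

text \<open>
  On a type of sets \<open>\<le>\<close> is inclusion, so \<open>order_ideals P\<close> is itself a poset in the above sense.
\<close>

definition order_ideals :: "'a::order set \<Rightarrow> 'a set set" where
  "order_ideals P = {I. I \<subseteq> P \<and> (\<forall>x\<in>I. \<forall>y\<in>P. y \<le> x \<longrightarrow> y \<in> I)}"

text \<open>The pointwise real vector space structure on functions.\<close>

instantiation "fun" :: (type, real_vector) real_vector
begin

definition scaleR_fun :: "real \<Rightarrow> ('a \<Rightarrow> 'b) \<Rightarrow> 'a \<Rightarrow> 'b" where
  "scaleR_fun c f = (\<lambda>x. c *\<^sub>R f x)"

instance
  by standard (simp_all add: scaleR_fun_def fun_eq_iff scaleR_add_right scaleR_add_left)

end

text \<open>
  A real-valued function on \<open>order_ideals P\<close> is represented by its extension by \<open>0\<close> to all sets. In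
  particular the constant function \<open>1\<close> is \<open>indicator (order_ideals P)\<close>.
\<close>

definition ideal_ind :: "'a::order set \<Rightarrow> 'a \<Rightarrow> 'a set \<Rightarrow> real" where
  "ideal_ind P p = indicator {I \<in> order_ideals P. p \<in> I}"

definition toggle_minus :: "'a::order set \<Rightarrow> 'a \<Rightarrow> 'a set \<Rightarrow> real" where
  "toggle_minus P p =
     indicator {I \<in> order_ideals P. p \<in> I \<and> (\<forall>q\<in>I. p \<le> q \<longrightarrow> q = p)}"

definition toggle_plus :: "'a::order set \<Rightarrow> 'a \<Rightarrow> 'a set \<Rightarrow> real" where
  "toggle_plus P p = indicator {I \<in> order_ideals P. p \<notin> I \<and> I \<union> {p} \<in> order_ideals P}"

definition toggle :: "'a::order set \<Rightarrow> 'a \<Rightarrow> 'a set \<Rightarrow> real" where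
  "toggle P p = toggle_plus P p - toggle_minus P p"

definition I_T :: "'a::order set \<Rightarrow> ('a set \<Rightarrow> real) set" where
  "I_T P = span (ideal_ind P ` P) \<inter> span ({indicator (order_ideals P)} \<union> toggle P ` P)"

definition A_T :: "'a::order set \<Rightarrow> ('a set \<Rightarrow> real) set" where
  "A_T P = span (toggle_minus P ` P) \<inter> span ({indicator (order_ideals P)} \<union> toggle P ` P)"

end

theory Submission
  imports Defs
begin

text \<open>
  Write \<open>L\<close> for the lattice of order ideals of \<open>Q\<close>. The indicators of \<open>{I. K \<subseteq> I}\<close>, for ideals \<open>K\<close>
  of \<open>L\<close>, are linearly independent, and the space \<open>V\<close> spanned by all \<open>ideal_ind L p\<close> and
  \<open>toggle_plus L p\<close> is spanned by those with \<open>K = {r. r \<le> p}\<close> or \<open>K = {r. r < p}\<close>. The second kind is of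
  the first kind exactly when \<open>p\<close> is join irreducible, so \<open>dim V = 2 |L| - |Q|\<close>. In width two, the local
  relations along covers and around the squares \<open>p, p \<union> {x}, p \<union> {y}, p \<union> {x, y}\<close> of \<open>L\<close> show that the
  span of \<open>1\<close> and the toggles adds up to \<open>V\<close> both with the span of the \<open>ideal_ind L p\<close> and with the
  span of the \<open>toggle_minus L p\<close>. The three spans have dimensions \<open>|L| + 1\<close>, \<open>|L|\<close> and \<open>|L|\<close>, so both
  intersections have dimension \<open>|Q| + 1\<close>, which is \<open>rk L + 1\<close>.
\<close>

section \<open>Dimension of an intersection of spans\<close>

text \<open>Grassmann's formula: a basis \<open>C\<close> of the intersection extends to bases
  \<open>B\<close> and \<open>D\<close> of the two spans, and \<open>B \<union> (D - C)\<close> is a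
  basis of their sum.\<close>

lemma dim_span_Int_span:
  fixes S T :: "'v::real_vector set"
  assumes "finite S" "finite T"
  shows "dim (span S \<inter> span T) + dim (S \<union> T) = dim S + dim T"
proof -
  let ?U = "span S \<inter> span T"
  obtain C where C: "C \<subseteq> ?U" "independent C" "?U \<subseteq> span C"
    using maximal_independent_subset by blast
  obtain B where B: "C \<subseteq> B" "B \<subseteq> span S" "independent B" "span S \<subseteq> span B"
    using maximal_independent_subset_extend[of C "span S"] C by auto
  obtain D where D: "C \<subseteq> D" "D \<subseteq> span T" "independent D" "span T \<subseteq> span D"
    using maximal_independent_subset_extend[of C "span T"] C by auto
  have fin: "finite B" "finite D" "finite C"
    using independent_span_bound assms B D finite_subset by metis+
  have disj: "B \<inter> (D - C) = {}"
  proof (rule ccontr)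
    assume "B \<inter> (D - C) \<noteq> {}"
    then obtain d where d: "d \<in> D" "d \<notin> C" "d \<in> span C" using B D C by blast
    then have "d \<in> span (D - {d})" using span_mono[of C "D - {d}"] D(1) by blast
    then show False using d D(3) by (auto simp: dependent_def)
  qed
  have indep: "independent (B \<union> (D - C))"
  proof (rule independent_if_scalars_zero)
    show "finite (B \<union> (D - C))" using fin by auto
    fix u x
    assume s: "(\<Sum>v\<in>B \<union> (D - C). u v *\<^sub>R v) = 0" and x: "x \<in> B \<union> (D - C)"
    have split: "(\<Sum>v\<in>B. u v *\<^sub>R v) + (\<Sum>v\<in>D - C. u v *\<^sub>R v) = 0"
      using s fin disj by (subst (asm) sum.union_disjoint) auto
    \<comment> \<open>The part of the relation over \<open>D - C\<close> lies in both spans, hence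
      in \<open>span C\<close>.\<close>
    have "(\<Sum>v\<in>D - C. u v *\<^sub>R v) = - (\<Sum>v\<in>B. u v *\<^sub>R v)"
      using split by (simp add: eq_neg_iff_add_eq_0 add.commute)
    also have "\<dots> \<in> span S"
      using B by (intro span_neg span_sum span_scale) auto
    finally have "(\<Sum>v\<in>D - C. u v *\<^sub>R v) \<in> span S" .
    moreover have "(\<Sum>v\<in>D - C. u v *\<^sub>R v) \<in> span T"
      using D by (intro span_sum span_scale) auto
    ultimately have "(\<Sum>v\<in>D - C. u v *\<^sub>R v) \<in> span C" using C by blast
    then obtain w where w: "(\<Sum>v\<in>D - C. u v *\<^sub>R v) = (\<Sum>v\<in>C. w v *\<^sub>R v)"
      using span_finite[OF fin(3)] by auto
    \<comment> \<open>Coefficients of the resulting relation on \<open>D\<close>: the combination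
      over \<open>C\<close> is moved to the left.\<close>
    define z where "z v = (if v \<in> C then - w v else u v)" for v
    have "(\<Sum>v\<in>D. z v *\<^sub>R v) = (\<Sum>v\<in>D - C. z v *\<^sub>R v) + (\<Sum>v\<in>C. z v *\<^sub>R v)"
      using sum.subset_diff[OF D(1) fin(2)] .
    also have "\<dots> = (\<Sum>v\<in>D - C. u v *\<^sub>R v) + (\<Sum>v\<in>C. - (w v *\<^sub>R v))"
      by (intro arg_cong2[where f = "(+)"] sum.cong) (auto simp: z_def)
    also have "\<dots> = 0" using w by (simp add: sum_negf)
    finally have "z v = 0" if "v \<in> D" for v
      using independentD[OF D(3) fin(2) subset_refl] that by blast
    then have u0: "u v = 0" if "v \<in> D - C" for v
      using that by (force simp: z_def)
    then have "(\<Sum>v\<in>B. u v *\<^sub>R v) = 0"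
      using split by simp
    then have "u v = 0" if "v \<in> B" for v
      using independentD[OF B(3) fin(1) subset_refl] that by blast
    then show "u x = 0" using u0 x by blast
  qed
  have "span (B \<union> (D - C)) = span (S \<union> T)"
  proof
    show "span (B \<union> (D - C)) \<subseteq> span (S \<union> T)"
      using B(2) D(2) span_mono[of S "S \<union> T"] span_mono[of T "S \<union> T"]
      by (intro span_minimal subspace_span) blast
    have "span B \<subseteq> span (B \<union> (D - C))" "span D \<subseteq> span (B \<union> (D - C))"
      using B(1) by (intro span_mono; blast)+
    then show "span (S \<union> T) \<subseteq> span (B \<union> (D - C))"
      using B(4) D(4) span_superset[of S] span_superset[of T]
      by (intro span_minimal subspace_span) blast
  qed
  then have "dim (S \<union> T) = card (B \<union> (D - C))"
    using indep by (metis dim_eq_card)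
  also have "\<dots> = card B + (card D - card C)"
    using disj fin D(1) by (simp add: card_Un_disjoint card_Diff_subset)
  finally have "dim (S \<union> T) = card B + (card D - card C)" .
  moreover have "dim ?U = card C" "dim S = card B" "dim T = card D"
    using basis_card_eq_dim[of C ?U] basis_card_eq_dim[of B "span S"]
      basis_card_eq_dim[of D "span T"] B C D by simp_all
  moreover have "card C \<le> card D" using D(1) fin by (simp add: card_mono)
  ultimately show ?thesis by simp
qed

text \<open>Independence is a property of sets of vectors, so for a family injectivity comes
  separately: a repeated value would give a relation with coefficients 1 and -1.\<close>

lemma independent_family:
  fixes f :: "'i \<Rightarrow> 'v::real_vector"
  assumes "finite A"
    and zero: "\<And>u i. (\<Sum>i\<in>A. u i *\<^sub>R f i) = 0 \<Longrightarrow> i \<in> A \<Longrightarrow> u i = 0"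
  shows "inj_on f A" "independent (f ` A)"
proof -
  show inj: "inj_on f A"
  proof (rule inj_onI, rule ccontr)
    fix i j assume ij: "i \<in> A" "j \<in> A" "f i = f j" "i \<noteq> j"
    define u :: "'i \<Rightarrow> real" where "u k = (if k = i then 1 else 0) - (if k = j then 1 else 0)" for k
    have "(\<Sum>k\<in>A. u k *\<^sub>R f k) =
        (\<Sum>k\<in>A. if k = i then f k else 0) - (\<Sum>k\<in>A. if k = j then f k else 0)"
      unfolding sum_subtractf[symmetric] by (intro sum.cong) (auto simp: u_def)
    also have "\<dots> = 0" using ij \<open>finite A\<close> by simp
    finally have "u i = 0" using zero ij by blast
    then show False using ij by (simp add: u_def)
  qed
  show "independent (f ` A)"
  proof (rule independent_if_scalars_zero)
    show "finite (f ` A)" using \<open>finite A\<close> by simp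
    fix u x assume "(\<Sum>x\<in>f ` A. u x *\<^sub>R x) = 0" "x \<in> f ` A"
    then show "u x = 0"
      using zero[of "\<lambda>i. u (f i)"] inj by (auto simp: sum.reindex)
  qed
qed

lemma dim_family:
  fixes f :: "'i \<Rightarrow> 'v::real_vector"
  assumes "finite A"
    and "\<And>u i. (\<Sum>i\<in>A. u i *\<^sub>R f i) = 0 \<Longrightarrow> i \<in> A \<Longrightarrow> u i = 0"
  shows "dim (f ` A) = card A"
proof -
  have "inj_on f A" "independent (f ` A)"
    by (rule independent_family; fact assms)+
  then show ?thesis by (simp add: dim_eq_card_independent card_image)
qed

lemma sum_scaleR_fun_apply:
  fixes f :: "'i \<Rightarrow> 'b \<Rightarrow> real"
  shows "(\<Sum>i\<in>A. u i *\<^sub>R f i) x = (\<Sum>i\<in>A. u i * f i x)"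
  by (induction A rule: infinite_finite_induct) (simp_all add: scaleR_fun_def)

section \<open>Order ideals and toggles of a finite poset\<close>

lemma finite_order_ideals: "finite P \<Longrightarrow> finite (order_ideals P)"
  by (rule finite_subset[of _ "Pow P"]) (auto simp: order_ideals_def)

lemma order_idealsD: "I \<in> order_ideals P \<Longrightarrow> x \<in> I \<Longrightarrow> y \<in> P \<Longrightarrow> y \<le> x \<Longrightarrow> y \<in> I"
  by (auto simp: order_ideals_def)

lemma order_ideals_subset: "I \<in> order_ideals P \<Longrightarrow> I \<subseteq> P"
  by (auto simp: order_ideals_def)

lemma principal_in_order_ideals:
  "{q \<in> P. q \<le> p} \<in> order_ideals P" "{q \<in> P. q < p} \<in> order_ideals P"
  by (auto simp: order_ideals_def)

text \<open>The zeta function of the inclusion order, with the smaller argument fixed. It serves as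
  a common basis in which \<open>ideal_ind\<close> and \<open>toggle_plus\<close> are
  compared.\<close>

definition ideal_zeta :: "'a::order set \<Rightarrow> 'a set \<Rightarrow> 'a set \<Rightarrow> real" where
  "ideal_zeta P K = indicator {I \<in> order_ideals P. K \<subseteq> I}"

lemma ideal_ind_eq_zeta: "p \<in> P \<Longrightarrow> ideal_ind P p = ideal_zeta P {q \<in> P. q \<le> p}"
  unfolding ideal_ind_def ideal_zeta_def
  by (rule arg_cong[where f = indicator]) (auto dest: order_idealsD)

lemma insert_in_order_ideals_iff:
  assumes "I \<in> order_ideals P" "p \<in> P"
  shows "I \<union> {p} \<in> order_ideals P \<longleftrightarrow> {q \<in> P. q < p} \<subseteq> I"
  using assms unfolding order_ideals_def by (auto simp: order.order_iff_strict)

text \<open>\<open>p\<close> can be added when everything strictly below it is present and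
  \<open>p\<close> is not; since presence of \<open>p\<close> forces everything below it, the
  indicator is a difference of nested ones.\<close>

lemma toggle_plus_eq_zeta:
  assumes "p \<in> P"
  shows "toggle_plus P p = ideal_zeta P {q \<in> P. q < p} - ideal_ind P p"
proof
  fix I
  show "toggle_plus P p I = (ideal_zeta P {q \<in> P. q < p} - ideal_ind P p) I"
    using insert_in_order_ideals_iff[of I P p] assms order_idealsD[of I P p]
    by (auto simp: toggle_plus_def ideal_zeta_def ideal_ind_def indicator_def order.strict_iff_order)
qed

text \<open>The zeta matrix is unitriangular for inclusion, so coefficients vanish one after
  another, from small ideals to large.\<close>

lemma dim_zeta_family:
  assumes "finite P" "K \<subseteq> order_ideals P"
  shows "dim (ideal_zeta P ` K) = card K"
proof (rule dim_family)
  show "finite K" using assms finite_order_ideals finite_subset by blast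
  fix u :: "'a set \<Rightarrow> real" and i assume s: "(\<Sum>i\<in>K. u i *\<^sub>R ideal_zeta P i) = 0"
  assume "i \<in> K"
  then have "i \<subseteq> P" using assms(2) order_ideals_subset by blast
  then have "finite i" using assms(1) by (rule finite_subset)
  then show "u i = 0" using \<open>i \<in> K\<close>
  proof (induction i rule: finite_psubset_induct)
    case (psubset I)
    have "0 = (\<Sum>i\<in>K. u i * ideal_zeta P i I)"
      using s sum_scaleR_fun_apply[of u "ideal_zeta P" K I] by simp
    \<comment> \<open>At \<open>I\<close> only indices contained in \<open>I\<close> contribute, and
      the proper subsets have coefficient 0 by induction.\<close>
    also have "\<dots> = (\<Sum>i\<in>K. if i = I then u I else 0)"
      using psubset assms by (intro sum.cong) (auto simp: ideal_zeta_def indicator_def)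
    also have "\<dots> = u I" using \<open>finite K\<close> psubset by simp
    finally show ?case by simp
  qed
qed

lemma inj_on_principal: "inj_on (\<lambda>p. {q \<in> P. q \<le> p}) (P :: 'a::order set)"
  by (rule inj_onI) (auto intro: order.antisym)

lemma dim_ideal_ind:
  assumes "finite P"
  shows "dim (ideal_ind P ` P) = card P"
proof -
  have "ideal_ind P ` P = ideal_zeta P ` (\<lambda>p. {q \<in> P. q \<le> p}) ` P"
    by (simp add: image_image ideal_ind_eq_zeta)
  then show ?thesis
    using dim_zeta_family[OF assms, of "(\<lambda>p. {q \<in> P. q \<le> p}) ` P"]
    by (simp add: card_image inj_on_principal principal_in_order_ideals image_subset_iff)
qed

text \<open>The principal ideal of \<open>p\<close> has \<open>p\<close> as its only maximal
  element, so evaluating a relation there isolates \<open>u p\<close>.\<close>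

lemma dim_toggle_minus:
  assumes "finite P"
  shows "dim (toggle_minus P ` P) = card P"
proof (rule dim_family[OF assms])
  fix u :: "'a \<Rightarrow> real" and p
  assume s: "(\<Sum>i\<in>P. u i *\<^sub>R toggle_minus P i) = 0" and p: "p \<in> P"
  have "0 = (\<Sum>i\<in>P. u i * toggle_minus P i {q \<in> P. q \<le> p})"
    using s sum_scaleR_fun_apply[of u "toggle_minus P" P "{q \<in> P. q \<le> p}"] by simp
  also have "\<dots> = (\<Sum>i\<in>P. if i = p then u p else 0)"
    using p by (intro sum.cong)
      (auto simp: toggle_minus_def indicator_def principal_in_order_ideals)
  also have "\<dots> = u p" using assms p by simp
  finally show "u p = 0" by simp
qed

text \<open>Adding \<open>p\<close> is a bijection from the ideals to which \<open>p\<close> can be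
  added onto those in which \<open>p\<close> is maximal.\<close>

lemma sum_toggle_minus:
  assumes "finite P" "p \<in> P"
  shows "(\<Sum>I\<in>order_ideals P. g I * toggle_minus P p I) =
    (\<Sum>I\<in>order_ideals P. g (I \<union> {p}) * toggle_plus P p I)"
proof -
  let ?J = "order_ideals P"
  let ?M = "{I \<in> ?J. p \<in> I \<and> (\<forall>q\<in>I. p \<le> q \<longrightarrow> q = p)}"
  let ?N = "{I \<in> ?J. p \<notin> I \<and> I \<union> {p} \<in> ?J}"
  note fin = finite_order_ideals[OF assms(1)]
  have "(\<Sum>I\<in>?J. g I * toggle_minus P p I) = sum g ?M"
    unfolding toggle_minus_def using fin by (subst sum_mult_indicator) (auto simp: Int_def intro: sum.cong)
  also have "\<dots> = (\<Sum>I\<in>?N. g (I \<union> {p}))"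
  proof (rule sum.reindex_bij_witness[of _ "\<lambda>I. I \<union> {p}" "\<lambda>I. I - {p}"])
    show "I \<union> {p} \<in> ?M" if "I \<in> ?N" for I
      using that order_idealsD[of I P _ p] assms(2) by auto
    show "I - {p} \<in> ?N" if "I \<in> ?M" for I
      using that by (auto simp: order_ideals_def insert_absorb)
  qed (auto simp: insert_absorb)
  also have "\<dots> = (\<Sum>I\<in>?J. g (I \<union> {p}) * toggle_plus P p I)"
    unfolding toggle_plus_def using fin by (subst sum_mult_indicator) (auto simp: Int_def intro: sum.cong)
  finally show ?thesis .
qed

text \<open>
  With \<open>F I = (\<Sum>p\<in>I. u p)\<close>, the combination of toggles is the graph Laplacian of \<open>F\<close> on the order
  ideals; summing it against \<open>1\<close> gives \<open>a = 0\<close>, and against \<open>F\<close> a vanishing energy.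
\<close>

lemma toggle_combination_zero:
  assumes "finite P"
    and zero: "\<And>I. I \<in> order_ideals P \<Longrightarrow> a + (\<Sum>p\<in>P. u p * toggle P p I) = 0"
  shows "a = 0" "\<forall>p\<in>P. u p = 0"
proof -
  let ?J = "order_ideals P"
  define F where "F I = (\<Sum>p\<in>I. u p)" for I
  \<comment> \<open>Summation by parts: each pair \<open>I\<close>, \<open>I \<union> {p}\<close>
    contributes \<open>g\<close> at its lower end and \<open>- g\<close> at its upper end.\<close>
  have sumT: "(\<Sum>I\<in>?J. g I * toggle P p I) =
      (\<Sum>I\<in>?J. (g I - g (I \<union> {p})) * toggle_plus P p I)" if "p \<in> P" for p g
    using sum_toggle_minus[OF assms(1) that, of g]
    by (simp add: toggle_def algebra_simps sum_subtractf)
  have swap: "(\<Sum>I\<in>?J. g I * (a + (\<Sum>p\<in>P. u p * toggle P p I))) =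
      a * (\<Sum>I\<in>?J. g I) + (\<Sum>p\<in>P. u p * (\<Sum>I\<in>?J. g I * toggle P p I))" for g
  proof -
    have "(\<Sum>I\<in>?J. g I * (a + (\<Sum>p\<in>P. u p * toggle P p I))) =
       a * (\<Sum>I\<in>?J. g I) + (\<Sum>I\<in>?J. \<Sum>p\<in>P. u p * (g I * toggle P p I))"
      by (simp add: algebra_simps sum.distrib sum_distrib_left)
    then show ?thesis by (subst (asm) sum.swap) (simp add: sum_distrib_left)
  qed
  have "{} \<in> ?J" by (simp add: order_ideals_def)
  then have "card ?J \<noteq> 0" using finite_order_ideals[OF assms(1)] by auto
  moreover have "a * real (card ?J) = 0"
    using swap[of "\<lambda>_. 1"] zero sumT[of _ "\<lambda>_. 1"] by simp
  ultimately show a: "a = 0" by simp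
  have F: "(\<Sum>I\<in>?J. F I * toggle P p I) = - u p * (\<Sum>I\<in>?J. toggle_plus P p I)"
    if p: "p \<in> P" for p
  proof -
    \<comment> \<open>Adding \<open>p\<close> to \<open>I\<close> raises \<open>F\<close> by
      \<open>u p\<close>; if \<open>p\<close> is already in \<open>I\<close>, then
      \<open>toggle_plus\<close> vanishes.\<close>
    have "(F I - F (I \<union> {p})) * toggle_plus P p I = - u p * toggle_plus P p I" if "I \<in> ?J" for I
    proof (cases "p \<in> I")
      case False
      have "finite I"
        using order_ideals_subset[OF that] assms(1) by (rule finite_subset)
      then show ?thesis using False by (simp add: F_def)
    qed (simp add: toggle_plus_def)
    then show ?thesis using sumT[OF p, of F] by (simp add: sum_distrib_left)
  qed
  have "(\<Sum>p\<in>P. u p * (\<Sum>I\<in>?J. F I * toggle P p I)) = 0"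
    using swap[of F] zero a by simp
  then have energy: "(\<Sum>p\<in>P. u p * u p * (\<Sum>I\<in>?J. toggle_plus P p I)) = 0"
    using F by (simp add: sum_negf mult.assoc)
  show "\<forall>p\<in>P. u p = 0"
  proof
    fix p assume p: "p \<in> P"
    have nonneg: "0 \<le> toggle_plus P q I" for q I by (simp add: toggle_plus_def)
    \<comment> \<open>The energy is a sum of nonnegative terms, so each of them is 0. The factor
      next to the square is positive, because \<open>p\<close> can be added to the ideal of elements
      strictly below it.\<close>
    have "u p * u p * (\<Sum>I\<in>?J. toggle_plus P p I) = 0"
      using energy p assms(1) nonneg
      by (subst (asm) sum_nonneg_eq_0_iff) (auto intro!: mult_nonneg_nonneg[OF zero_le_square] sum_nonneg)
    moreover have "(\<Sum>I\<in>?J. toggle_plus P p I) > 0"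
    proof (rule sum_pos2[of _ "{q \<in> P. q < p}"])
      show "0 < toggle_plus P p {q \<in> P. q < p}"
        using insert_in_order_ideals_iff[OF principal_in_order_ideals(2) p, of p]
          principal_in_order_ideals(2)[of P p]
        by (simp add: toggle_plus_def)
    qed (auto simp: finite_order_ideals assms principal_in_order_ideals nonneg)
    ultimately show "u p = 0" by auto
  qed
qed

lemma dim_toggle:
  assumes "finite P"
  shows "dim ({indicator (order_ideals P)} \<union> toggle P ` P) = card P + 1"
proof -
  have zero: "u p = 0" if "(\<Sum>p\<in>P. u p *\<^sub>R toggle P p) = 0" "p \<in> P" for u p
  proof -
    have "0 + (\<Sum>p\<in>P. u p * toggle P p I) = 0" for I
      using that(1) sum_scaleR_fun_apply[of u "toggle P" P I] by simp
    then show ?thesis using toggle_combination_zero(2)[OF assms] that(2) by blast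
  qed
  have fam: "inj_on (toggle P) P" "independent (toggle P ` P)"
    by (rule independent_family; fact assms zero)+
  have "(indicator (order_ideals P) :: _ \<Rightarrow> real) \<notin> span (toggle P ` P)"
  proof
    assume "(indicator (order_ideals P) :: _ \<Rightarrow> real) \<in> span (toggle P ` P)"
    then obtain v where "(indicator (order_ideals P) :: _ \<Rightarrow> real) = (\<Sum>t\<in>toggle P ` P. v t *\<^sub>R t)"
      using span_finite[of "toggle P ` P"] assms by auto
    also have "\<dots> = (\<Sum>p\<in>P. v (toggle P p) *\<^sub>R toggle P p)"
      using fam(1) by (simp add: sum.reindex)
    finally have eq: "indicator (order_ideals P) = (\<Sum>p\<in>P. v (toggle P p) *\<^sub>R toggle P p)" .
    \<comment> \<open>Writing the constant 1 through toggles would be a vanishing combination with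
      \<open>a = -1\<close>.\<close>
    have "-1 + (\<Sum>p\<in>P. v (toggle P p) * toggle P p I) = 0" if "I \<in> order_ideals P" for I
      using fun_cong[OF eq, of I] that by (simp add: sum_scaleR_fun_apply)
    from toggle_combination_zero(1)[OF assms this] show False by simp
  qed
  moreover from this have "(indicator (order_ideals P) :: _ \<Rightarrow> real) \<notin> toggle P ` P"
    using span_base by blast
  ultimately have "independent (insert (indicator (order_ideals P)) (toggle P ` P))"
      "(indicator (order_ideals P) :: _ \<Rightarrow> real) \<notin> toggle P ` P"
    using fam(2) independent_insertI by blast+
  then show ?thesis
    using assms fam(1) by (simp add: dim_eq_card_independent card_image)
qed

section \<open>The distributive lattice of order ideals\<close>

text \<open>A minimal element of \<open>r - p\<close> works: everything strictly below it lies in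
  \<open>r\<close>, hence by minimality in \<open>p\<close>.\<close>

lemma exists_addable:
  assumes "finite Q" "p \<in> order_ideals Q" "r \<in> order_ideals Q" "p \<subset> r"
  obtains x where "x \<in> r" "x \<notin> p" "insert x p \<in> order_ideals Q"
proof -
  have "finite (r - p)" "r - p \<noteq> {}"
    using assms order_ideals_subset[of r Q] by (auto intro: finite_subset[OF _ assms(1)])
  then obtain x where x: "x \<in> r - p" "\<forall>y\<in>r - p. y \<le> x \<longrightarrow> x = y"
    using finite_has_minimal by blast
  then have "insert x p \<in> order_ideals Q"
    using assms unfolding order_ideals_def by blast
  then show thesis using that x by blast
qed

text \<open>Dually, a maximal element of \<open>q - r\<close> works: an element of \<open>r\<close>
  above it would force it into \<open>r\<close>.\<close>

lemma exists_removable: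
  assumes "finite Q" "q \<in> order_ideals Q" "r \<in> order_ideals Q" "r \<subset> q"
  obtains x where "x \<in> q" "x \<notin> r" "q - {x} \<in> order_ideals Q"
proof -
  have "finite (q - r)" "q - r \<noteq> {}"
    using assms order_ideals_subset[of q Q] by (auto intro: finite_subset[OF _ assms(1)])
  then obtain x where x: "x \<in> q - r" "\<forall>y\<in>q - r. x \<le> y \<longrightarrow> x = y"
    using finite_has_maximal by blast
  have "y = x" if "y \<in> q" "x \<le> y" for y
  proof (cases "y \<in> r")
    case True
    then have "x \<in> r"
      using order_idealsD[OF assms(3) _ _ that(2)] x(1) order_ideals_subset[OF assms(2)] by blast
    then show ?thesis using x(1) by simp
  qed (use that x in auto)
  then have "q - {x} \<in> order_ideals Q"
    using assms(2) unfolding order_ideals_def by auto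
  then show thesis using that x by blast
qed

lemma order_ideals_mono_mem:
  "I \<in> order_ideals (order_ideals Q) \<Longrightarrow> r \<in> I \<Longrightarrow> s \<in> order_ideals Q \<Longrightarrow> s \<subseteq> r \<Longrightarrow> s \<in> I"
  by (rule order_idealsD)

text \<open>Here \<open>p\<close> has the unique upper cover \<open>insert x p\<close>, contained in
  every ideal strictly above \<open>p\<close>; so \<open>p\<close> is maximal in \<open>I\<close>
  exactly when \<open>I\<close> contains \<open>p\<close> but not this cover.\<close>

lemma toggle_minus_unique_addable:
  assumes "finite Q" "p \<in> order_ideals Q" "x \<notin> p" "insert x p \<in> order_ideals Q"
    and uniq: "\<And>z. z \<notin> p \<Longrightarrow> insert z p \<in> order_ideals Q \<Longrightarrow> z = x"
  shows "toggle_minus (order_ideals Q) p =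
    ideal_ind (order_ideals Q) p - ideal_ind (order_ideals Q) (insert x p)"
proof
  fix I
  let ?L = "order_ideals Q"
  have "(\<forall>r\<in>I. p \<subseteq> r \<longrightarrow> r = p) \<longleftrightarrow> insert x p \<notin> I" if I: "I \<in> order_ideals ?L"
  proof
    assume n: "insert x p \<notin> I"
    show "\<forall>r\<in>I. p \<subseteq> r \<longrightarrow> r = p"
    proof (intro ballI impI, rule ccontr)
      fix r assume r: "r \<in> I" "p \<subseteq> r" "r \<noteq> p"
      then have "r \<in> ?L" using order_ideals_subset[OF I] by blast
      then obtain z where "z \<in> r" "z \<notin> p" "insert z p \<in> ?L"
        using exists_addable[OF assms(1,2), of r] r by blast
      then have "insert x p \<subseteq> r" using uniq r by blast
      then show False using n order_ideals_mono_mem[OF I r(1) assms(4)] by blast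
    qed
  qed (use assms(3) in auto)
  moreover have "p \<in> I" if "I \<in> order_ideals ?L" "insert x p \<in> I"
    using order_ideals_mono_mem[OF that assms(2)] by blast
  ultimately show "toggle_minus ?L p I = (ideal_ind ?L p - ideal_ind ?L (insert x p)) I"
    by (auto simp: toggle_minus_def ideal_ind_def indicator_def)
qed

lemma toggle_minus_top:
  "toggle_minus (order_ideals Q) Q = ideal_ind (order_ideals Q) Q"
proof -
  have "q = Q" if "I \<in> order_ideals (order_ideals Q)" "q \<in> I" "Q \<subseteq> q" for I q
    using that order_ideals_subset[OF that(1)] order_ideals_subset[of q Q] by blast
  then have "{I \<in> order_ideals (order_ideals Q). Q \<in> I \<and> (\<forall>q\<in>I. Q \<le> q \<longrightarrow> q = Q)} =
      {I \<in> order_ideals (order_ideals Q). Q \<in> I}"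
    by blast
  then show ?thesis unfolding toggle_minus_def ideal_ind_def by simp
qed

text \<open>Here \<open>q - {x}\<close> is the unique lower cover of \<open>q\<close>, so the
  elements of the lattice strictly below \<open>q\<close> form a principal ideal.\<close>

lemma toggle_plus_unique_removable:
  assumes "finite Q" "q \<in> order_ideals Q" "x \<in> q" "q - {x} \<in> order_ideals Q"
    and uniq: "\<And>z. z \<in> q \<Longrightarrow> q - {z} \<in> order_ideals Q \<Longrightarrow> z = x"
  shows "toggle_plus (order_ideals Q) q =
    ideal_ind (order_ideals Q) (q - {x}) - ideal_ind (order_ideals Q) q"
proof -
  have "{r \<in> order_ideals Q. r < q} = {r \<in> order_ideals Q. r \<le> q - {x}}"
  proof (intro Collect_cong conj_cong refl)
    fix r assume r: "r \<in> order_ideals Q"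
    show "r < q \<longleftrightarrow> r \<le> q - {x}"
    proof
      assume "r < q"
      then obtain z where "z \<in> q" "z \<notin> r" "q - {z} \<in> order_ideals Q"
        using exists_removable[OF assms(1,2) r] by blast
      then show "r \<le> q - {x}" using uniq \<open>r < q\<close> by blast
    qed (use assms(3) in auto)
  qed
  then show ?thesis
    using toggle_plus_eq_zeta[OF assms(2)] ideal_ind_eq_zeta[OF assms(4)] by simp
qed

lemma empty_in_order_ideals: "{} \<in> order_ideals Q"
  by (simp add: order_ideals_def)

lemma toggle_plus_empty:
  "toggle_plus (order_ideals Q) {} =
    indicator (order_ideals (order_ideals Q)) - ideal_ind (order_ideals Q) {}"
  by (subst toggle_plus_eq_zeta) (simp_all add: empty_in_order_ideals ideal_zeta_def)

text \<open>If \<open>x \<le> y\<close>, then the ideal \<open>insert y p\<close> would have to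
  contain \<open>x\<close>. Hence the elements that can be added to \<open>p\<close> form an
  antichain.\<close>

lemma addable_not_le:
  assumes "x \<notin> p" "insert x p \<in> order_ideals Q"
    and "y \<notin> p" "insert y p \<in> order_ideals Q" and "x \<noteq> y"
  shows "\<not> x \<le> y"
  using order_idealsD[OF assms(4), of y x] order_ideals_subset[OF assms(2)] assms by auto

section \<open>Local relations around squares in width at most two\<close>

locale finite_width_le_two =
  fixes Q :: "'a::order set"
  assumes finite: "finite Q"
    and antichain_card: "\<And>A. A \<subseteq> Q \<Longrightarrow> antichain A \<Longrightarrow> card A \<le> 2"
begin

abbreviation "L \<equiv> order_ideals Q"

lemma no_three_antichain:
  assumes "x \<in> Q" "y \<in> Q" "z \<in> Q"
    and "\<not> x \<le> y" "\<not> y \<le> x" "\<not> x \<le> z" "\<not> z \<le> x" "\<not> y \<le> z" "\<not> z \<le> y"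
  shows False
proof -
  have "card {x, y, z} = 3" using assms by (auto simp: card_insert_if)
  moreover have "antichain {x, y, z}" using assms by (auto simp: antichain_def)
  ultimately show False using antichain_card[of "{x, y, z}"] assms by auto
qed

context
  fixes p x y
  assumes p: "p \<in> L" and x: "x \<notin> p" "insert x p \<in> L" and y: "y \<notin> p" "insert y p \<in> L"
    and xy: "x \<noteq> y"
begin

lemma addable_incomparable: "\<not> x \<le> y" "\<not> y \<le> x"
  using addable_not_le[OF x y xy] addable_not_le[OF y x] xy by auto

lemma square_top: "insert x (insert y p) \<in> L"
  using x(2) y(2) unfolding order_ideals_def by auto

text \<open>The maximal elements of the top corner are \<open>x\<close> and \<open>y\<close> only: a
  third removable element \<open>z\<close> would lie in \<open>p\<close> and be incomparable to
  both, against the width bound.\<close>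

lemma below_square_top:
  assumes r: "r \<in> L" "r \<subset> insert x (insert y p)"
  shows "r \<subseteq> insert x p \<or> r \<subseteq> insert y p"
proof -
  let ?q = "insert x (insert y p)"
  obtain z where z: "z \<in> ?q" "z \<notin> r" "?q - {z} \<in> L"
    using exists_removable[OF finite square_top r] by blast
  show ?thesis
  proof (cases "z = x \<or> z = y")
    case False
    then have zp: "z \<in> p" using z by blast
    have Q: "x \<in> Q" "y \<in> Q" "z \<in> Q" using order_ideals_subset[OF square_top] zp by auto
    moreover have "\<not> z \<le> x" "\<not> z \<le> y"
      using order_idealsD[OF z(3), of _ z] Q False by auto
    moreover have "\<not> x \<le> z" "\<not> y \<le> z"
      using order_idealsD[OF p zp] Q x(1) y(1) by auto
    ultimately show ?thesis using no_three_antichain[of x y z] addable_incomparable by blast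
  qed (use r z in blast)
qed

text \<open>Elements that can be added to \<open>p\<close> are pairwise incomparable, so by the
  width bound there are none besides \<open>x\<close> and \<open>y\<close>.\<close>

lemma above_square_bot:
  assumes r: "r \<in> L" "p \<subset> r"
  shows "insert x p \<subseteq> r \<or> insert y p \<subseteq> r"
proof -
  obtain z where z: "z \<in> r" "z \<notin> p" "insert z p \<in> L"
    using exists_addable[OF finite p r] by blast
  show ?thesis
  proof (cases "z = x \<or> z = y")
    case False
    have "x \<in> Q" "y \<in> Q" "z \<in> Q"
      using order_ideals_subset[OF x(2)] order_ideals_subset[OF y(2)] order_ideals_subset[OF z(3)]
      by auto
    moreover have "\<not> x \<le> z" "\<not> z \<le> x" "\<not> y \<le> z" "\<not> z \<le> y"
      using addable_not_le[OF x z(2,3)] addable_not_le[OF z(2,3) x]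
        addable_not_le[OF y z(2,3)] addable_not_le[OF z(2,3) y] False by auto
    ultimately show ?thesis using no_three_antichain[of x y z] addable_incomparable by blast
  qed (use r z in blast)
qed

text \<open>Inclusion-exclusion over the two middle corners for the event that \<open>I\<close>
  contains \<open>p\<close> but neither of them. The event that both lie in \<open>I\<close> is that
  everything strictly below the top corner does, and its indicator is \<open>ideal_ind\<close> plus
  \<open>toggle_plus\<close> at the top.\<close>

lemma square_relation:
  "toggle_minus L p = ideal_ind L p - ideal_ind L (insert x p) - ideal_ind L (insert y p)
    + ideal_ind L (insert x (insert y p)) + toggle_plus L (insert x (insert y p))"
proof
  fix I
  let ?q = "insert x (insert y p)"
  have X: "(\<forall>r\<in>I. p \<subseteq> r \<longrightarrow> r = p) \<longleftrightarrow> insert x p \<notin> I \<and> insert y p \<notin> I"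
    if I: "I \<in> order_ideals L"
  proof
    assume n: "insert x p \<notin> I \<and> insert y p \<notin> I"
    show "\<forall>r\<in>I. p \<subseteq> r \<longrightarrow> r = p"
    proof (intro ballI impI, rule ccontr)
      fix r assume r: "r \<in> I" "p \<subseteq> r" "r \<noteq> p"
      then have "r \<in> L" using order_ideals_subset[OF I] by blast
      then have "insert x p \<subseteq> r \<or> insert y p \<subseteq> r" using above_square_bot[of r] r by blast
      then show False
        using n order_ideals_mono_mem[OF I r(1) x(2)] order_ideals_mono_mem[OF I r(1) y(2)]
        by blast
    qed
  qed (use x y in auto)
  have Y: "{r \<in> L. r < ?q} \<subseteq> I \<longleftrightarrow> insert x p \<in> I \<and> insert y p \<in> I"
    if I: "I \<in> order_ideals L"
  proof
    assume "{r \<in> L. r < ?q} \<subseteq> I"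
    moreover have "insert x p < ?q" "insert y p < ?q" using x y xy by auto
    ultimately show "insert x p \<in> I \<and> insert y p \<in> I" using x y by blast
  next
    assume xI: "insert x p \<in> I \<and> insert y p \<in> I"
    show "{r \<in> L. r < ?q} \<subseteq> I"
    proof
      fix r assume "r \<in> {r \<in> L. r < ?q}"
      then have "r \<in> L" "r \<subseteq> insert x p \<or> r \<subseteq> insert y p"
        using below_square_top by simp_all
      then show "r \<in> I" using xI order_ideals_mono_mem[OF I] by metis
    qed
  qed
  have Z: "p \<in> I" if "I \<in> order_ideals L" "insert x p \<in> I \<or> insert y p \<in> I"
    using order_ideals_mono_mem[OF that(1) _ p] that(2) by blast
  show "toggle_minus L p I = (ideal_ind L p - ideal_ind L (insert x p) - ideal_ind L (insert y p)
      + ideal_ind L ?q + toggle_plus L ?q) I"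
  proof (cases "I \<in> order_ideals L")
    case True
    then show ?thesis
      using X[OF True] Y[OF True] Z[OF True]
      unfolding toggle_plus_eq_zeta[OF square_top]
      by (auto simp: toggle_minus_def ideal_zeta_def ideal_ind_def indicator_def)
  qed (simp add: toggle_minus_def toggle_plus_def ideal_ind_def)
qed

end

text \<open>The square relation indexed by its top corner, which suits inductions from small ideals
  to large ones.\<close>

lemma removable_square:
  assumes "q \<in> L" "x \<in> q" "y \<in> q" "x \<noteq> y" "q - {x} \<in> L" "q - {y} \<in> L"
  shows "toggle_minus L (q - {x, y}) =
    ideal_ind L (q - {x, y}) - ideal_ind L (q - {y}) - ideal_ind L (q - {x})
      + ideal_ind L q + toggle_plus L q" "q - {x, y} \<in> L"
proof -
  have "q - {x, y} = (q - {x}) \<inter> (q - {y})" by blast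
  moreover have "r \<inter> s \<in> L" if "r \<in> L" "s \<in> L" for r s
    using that unfolding order_ideals_def by blast
  ultimately show L: "q - {x, y} \<in> L" using assms(5,6) by metis
  have eq: "insert x (q - {x, y}) = q - {y}" "insert y (q - {x, y}) = q - {x}"
      "insert x (q - {x}) = q"
    using assms by auto
  show "toggle_minus L (q - {x, y}) =
    ideal_ind L (q - {x, y}) - ideal_ind L (q - {y}) - ideal_ind L (q - {x})
      + ideal_ind L q + toggle_plus L q"
    using square_relation[of "q - {x, y}" x y] L assms unfolding eq by auto
qed

text \<open>The case split of both inductions below: \<open>q\<close> is the bottom of the lattice,
  has a single lower cover, or is the top of a square.\<close>

lemma removable_cases:
  assumes "q \<in> L"
  obtains "q = {}"
  | x where "x \<in> q" "q - {x} \<in> L"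
      "toggle_plus L q = ideal_ind L (q - {x}) - ideal_ind L q"
  | x y where "x \<in> q" "y \<in> q" "x \<noteq> y" "q - {x} \<in> L" "q - {y} \<in> L"
proof (cases "q = {}")
  case False
  then obtain x where x: "x \<in> q" "q - {x} \<in> L"
    using exists_removable[OF finite assms empty_in_order_ideals] by blast
  show thesis
  proof (cases "\<exists>y. y \<in> q \<and> q - {y} \<in> L \<and> y \<noteq> x")
    case True
    then show thesis using that(3) x by blast
  next
    case False
    then show thesis
      using that(2)[OF x] toggle_plus_unique_removable[OF finite assms x] by blast
  qed
qed (use that in blast)

section \<open>The two sums of spans both equal \<open>V\<close>\<close>

abbreviation "V \<equiv> span (ideal_ind L ` L \<union> toggle_plus L ` L)"

lemma ind_in_V: "p \<in> L \<Longrightarrow> ideal_ind L p \<in> V"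
  by (rule span_base) blast

lemma toggle_plus_in_V: "p \<in> L \<Longrightarrow> toggle_plus L p \<in> V"
  by (rule span_base) blast

lemma one_in_V: "indicator (order_ideals L) \<in> V"
proof -
  have "toggle_plus L {} + ideal_ind L {} \<in> V"
    by (intro span_add ind_in_V toggle_plus_in_V empty_in_order_ideals)
  then show ?thesis by (simp add: toggle_plus_empty)
qed

text \<open>Upward case split: \<open>p\<close> is the top \<open>Q\<close>, has a single upper
  cover, or is the bottom of a square; each case has its formula for
  \<open>toggle_minus\<close>.\<close>

lemma toggle_minus_in_V:
  assumes p: "p \<in> L"
  shows "toggle_minus L p \<in> V"
proof (cases "p = Q")
  case True
  then show ?thesis using ind_in_V[OF p] by (simp only: toggle_minus_top)
next
  case False
  have "Q \<in> L" by (simp add: order_ideals_def)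
  moreover have "p \<subset> Q" using False order_ideals_subset[OF p] by blast
  ultimately obtain x where x: "x \<notin> p" "insert x p \<in> L"
    using exists_addable[OF finite p] by blast
  show ?thesis
  proof (cases "\<exists>y. y \<notin> p \<and> insert y p \<in> L \<and> y \<noteq> x")
    case True
    then obtain y where y: "y \<notin> p" "insert y p \<in> L" "x \<noteq> y" by blast
    show ?thesis
      unfolding square_relation[OF p x y]
      by (intro span_add span_diff ind_in_V toggle_plus_in_V p x y square_top[OF p x y])
  next
    case False
    then have "toggle_minus L p = ideal_ind L p - ideal_ind L (insert x p)"
      using toggle_minus_unique_addable[OF finite p x] by blast
    then show ?thesis using ind_in_V p x span_diff by metis
  qed
qed

lemma toggle_in_V: "p \<in> L \<Longrightarrow> toggle L p \<in> V"
  unfolding toggle_def by (intro span_diff toggle_plus_in_V toggle_minus_in_V)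

text \<open>What has to be recovered is \<open>toggle_plus\<close>, by induction on the
  ideal.\<close>

lemma span_ind_Un_toggle:
  "span (ideal_ind L ` L \<union> ({indicator (order_ideals L)} \<union> toggle L ` L)) = V"
  (is "span ?S = V")
proof
  show "span ?S \<subseteq> V"
    using ind_in_V one_in_V toggle_in_V by (intro span_minimal subspace_span) blast
  have base: "ideal_ind L p \<in> span ?S" "toggle L p \<in> span ?S" if "p \<in> L" for p
    using that by (auto intro: span_base)
  have one: "indicator (order_ideals L) \<in> span ?S" by (auto intro: span_base)
  have "toggle_plus L q \<in> span ?S" if "q \<in> L" for q
  proof -
    have "finite q" using order_ideals_subset[OF that] finite by (rule finite_subset)
    then show ?thesis using that
    proof (induction q rule: finite_psubset_induct)
      case (psubset q)
      from psubset.prems show ?case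
      proof (cases rule: removable_cases)
        case 1
        then show ?thesis
          using span_diff[OF one base(1)[OF empty_in_order_ideals]]
          by (simp only: toggle_plus_empty)
      next
        case (2 x)
        then show ?thesis
          using span_diff[OF base(1)[OF 2(2)] base(1)[OF psubset.prems]] by (simp only:)
      next
        case (3 x y)
        let ?p = "q - {x, y}"
        note sq = removable_square[OF psubset.prems 3]
        \<comment> \<open>Substituting \<open>toggle_minus = toggle_plus - toggle\<close> at the
          bottom corner into the square relation reduces \<open>toggle_plus\<close> at the top to
          \<open>toggle_plus\<close> at the bottom.\<close>
        have "toggle_plus L q = toggle_plus L ?p - toggle L ?p - ideal_ind L ?p
            + ideal_ind L (q - {y}) + ideal_ind L (q - {x}) - ideal_ind L q"
          using sq(1) by (simp add: toggle_def algebra_simps)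
        moreover have "toggle_plus L ?p \<in> span ?S" using psubset.IH[of ?p] sq(2) 3 by blast
        ultimately show ?thesis
          by (simp only:) (intro span_add span_diff base sq(2) 3 psubset.prems)
      qed
    qed
  qed
  then show "V \<subseteq> span ?S"
    using base by (intro span_minimal subspace_span) blast
qed

text \<open>Here \<open>toggle_plus\<close> is the sum of two generators, and the induction recovers
  \<open>ideal_ind\<close>: the square relation is solved for its value at the top, the other three
  corners being smaller.\<close>

lemma span_toggle_minus_Un_toggle:
  "span (toggle_minus L ` L \<union> ({indicator (order_ideals L)} \<union> toggle L ` L)) = V"
  (is "span ?S = V")
proof
  show "span ?S \<subseteq> V"
    using toggle_minus_in_V one_in_V toggle_in_V by (intro span_minimal subspace_span) blast
  have base: "toggle_minus L p \<in> span ?S" "toggle L p \<in> span ?S" if "p \<in> L" for p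
    using that by (auto intro: span_base)
  have one: "indicator (order_ideals L) \<in> span ?S" by (auto intro: span_base)
  have plus: "toggle_plus L q \<in> span ?S" if "q \<in> L" for q
    using span_add[OF base[OF that]] by (simp add: toggle_def)
  have "ideal_ind L q \<in> span ?S" if "q \<in> L" for q
  proof -
    have "finite q" using order_ideals_subset[OF that] finite by (rule finite_subset)
    then show ?thesis using that
    proof (induction q rule: finite_psubset_induct)
      case (psubset q)
      note plus_q = plus[OF psubset.prems]
      from psubset.prems show ?case
      proof (cases rule: removable_cases)
        case 1
        then show ?thesis
          using span_diff[OF one plus_q] by (simp add: toggle_plus_empty)
      next
        case (2 x)
        then have "ideal_ind L (q - {x}) \<in> span ?S" using psubset.IH[of "q - {x}"] by blast
        from span_diff[OF this plus_q] show ?thesis using 2 by simp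
      next
        case (3 x y)
        let ?p = "q - {x, y}"
        note sq = removable_square[OF psubset.prems 3]
        have "ideal_ind L q = toggle_minus L ?p - ideal_ind L ?p
            + ideal_ind L (q - {y}) + ideal_ind L (q - {x}) - toggle_plus L q"
          using sq(1) by (simp add: algebra_simps)
        moreover have "ideal_ind L ?p \<in> span ?S" "ideal_ind L (q - {x}) \<in> span ?S"
            "ideal_ind L (q - {y}) \<in> span ?S"
          using psubset.IH[of ?p] psubset.IH[of "q - {x}"] psubset.IH[of "q - {y}"] sq(2) 3
          by blast+
        ultimately show ?thesis
          by (simp only:) (intro span_add span_diff base sq(2) plus_q)
      qed
    qed
  qed
  then show "V \<subseteq> span ?S"
    using plus by (intro span_minimal subspace_span) blast
qed

end

section \<open>The dimension of \<open>V\<close>\<close>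

text \<open>An ideal properly inside the principal ideal of \<open>x\<close> cannot contain
  \<open>x\<close>. So principal ideals are join irreducible in the lattice, with the displayed
  lower cover.\<close>

lemma strictly_below_principal:
  assumes "x \<in> Q"
  shows "{r \<in> order_ideals Q. r < {y \<in> Q. y \<le> x}} = {r \<in> order_ideals Q. r \<le> {y \<in> Q. y < x}}"
proof (intro Collect_cong conj_cong refl)
  fix r assume r: "r \<in> order_ideals Q"
  show "r < {y \<in> Q. y \<le> x} \<longleftrightarrow> r \<le> {y \<in> Q. y < x}"
  proof
    assume l: "r < {y \<in> Q. y \<le> x}"
    then have "x \<notin> r" using order_idealsD[OF r] by blast
    then show "r \<le> {y \<in> Q. y < x}" using l by (auto simp: order.strict_iff_order)
  next
    assume "r \<le> {y \<in> Q. y < x}"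
    then show "r < {y \<in> Q. y \<le> x}" using assms by (auto simp: order.strict_iff_order)
  qed
qed

text \<open>A non-principal ideal is the union of the principal ideals of its elements, all of them
  proper. Thus \<open>q\<close> can be recovered from the set of ideals strictly below it.\<close>

lemma Union_strictly_below:
  assumes q: "q \<in> order_ideals Q" and n: "q \<notin> (\<lambda>x. {y \<in> Q. y \<le> x}) ` Q"
  shows "\<Union>{r \<in> order_ideals Q. r < q} = q"
proof
  show "q \<subseteq> \<Union>{r \<in> order_ideals Q. r < q}"
  proof
    fix x assume x: "x \<in> q"
    then have "{y \<in> Q. y \<le> x} \<subseteq> q" "x \<in> Q"
      using order_idealsD[OF q] order_ideals_subset[OF q] by auto
    then have "{y \<in> Q. y \<le> x} < q" "x \<in> {y \<in> Q. y \<le> x}" using n by auto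
    then show "x \<in> \<Union>{r \<in> order_ideals Q. r < q}"
      using principal_in_order_ideals(1) by blast
  qed
qed auto

lemma dim_span_ind_toggle_plus:
  fixes Q :: "'a::order set"
  assumes "finite Q"
  shows "dim (ideal_ind (order_ideals Q) ` order_ideals Q \<union> toggle_plus (order_ideals Q) ` order_ideals Q)
    + card Q = 2 * card (order_ideals Q)" (is "dim ?S + _ = _")
proof -
  let ?L = "order_ideals Q"
  define down where "down p = {r \<in> ?L. r \<le> p}" for p
  define sdown where "sdown p = {r \<in> ?L. r < p}" for p
  \<comment> \<open>The join irreducible elements of the lattice; for these \<open>sdown\<close>
    coincides with some \<open>down\<close>.\<close>
  define J where "J = (\<lambda>x. {y \<in> Q. y \<le> x}) ` Q"
  let ?K = "down ` ?L \<union> sdown ` ?L"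
  note finL = finite_order_ideals[OF assms]
  have plus: "toggle_plus ?L p = ideal_zeta ?L (sdown p) - ideal_zeta ?L (down p)"
    and ind: "ideal_ind ?L p = ideal_zeta ?L (down p)" if "p \<in> ?L" for p
    using toggle_plus_eq_zeta[OF that] ideal_ind_eq_zeta[OF that]
    by (simp_all add: down_def sdown_def)
  have "span ?S = span (ideal_zeta ?L ` ?K)"
  proof
    have "ideal_zeta ?L k \<in> span (ideal_zeta ?L ` ?K)" if "k \<in> ?K" for k
      using that by (blast intro: span_base)
    then show "span ?S \<subseteq> span (ideal_zeta ?L ` ?K)"
      by (intro span_minimal subspace_span) (auto simp: plus ind intro!: span_diff)
    have "ideal_zeta ?L (down p) \<in> span ?S" if "p \<in> ?L" for p
      using that ind by (metis UnCI imageI span_base)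
    moreover have "ideal_zeta ?L (sdown p) \<in> span ?S" if "p \<in> ?L" for p
    proof -
      have "toggle_plus ?L p + ideal_ind ?L p \<in> span ?S"
        using that by (intro span_add span_base) auto
      then show ?thesis using that by (simp add: plus ind)
    qed
    ultimately show "span (ideal_zeta ?L ` ?K) \<subseteq> span ?S"
      by (intro span_minimal subspace_span) blast
  qed
  then have "dim ?S = dim (ideal_zeta ?L ` ?K)" by (metis dim_span)
  also have "\<dots> = card ?K"
    using principal_in_order_ideals[of "?L"]
    by (intro dim_zeta_family finL) (auto simp: down_def sdown_def)
  finally have dimS: "dim ?S = card ?K" .
  have J: "J \<subseteq> ?L" "card J = card Q"
    using principal_in_order_ideals(1) by (auto simp: J_def card_image inj_on_principal)
  have sdown_J: "sdown p \<in> down ` ?L" if p: "p \<in> J" for p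
  proof -
    obtain x where x: "x \<in> Q" "p = {y \<in> Q. y \<le> x}" using p by (auto simp: J_def)
    then have "sdown p = down {y \<in> Q. y < x}"
      using strictly_below_principal unfolding down_def sdown_def by simp
    then show ?thesis using principal_in_order_ideals(2) by blast
  qed
  have U: "\<Union>(sdown p) = p" if "p \<in> ?L - J" for p
    using Union_strictly_below that unfolding sdown_def J_def by blast
  have "sdown p \<notin> down ` ?L" if "p \<in> ?L - J" for p
  proof
    assume "sdown p \<in> down ` ?L"
    then obtain c where c: "c \<in> ?L" "sdown p = down c" by blast
    \<comment> \<open>Taking unions in \<open>sdown p = down c\<close> gives \<open>c = p\<close>,
      so \<open>p\<close> would lie strictly below itself.\<close>
    have "\<Union>(down c) = c" using c(1) by (auto simp: down_def)
    then have "c = p" using U[OF that] c by simp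
    then have "c \<in> sdown c" using c by (simp add: down_def)
    then show False by (simp add: sdown_def)
  qed
  then have disj: "down ` ?L \<inter> sdown ` (?L - J) = {}" by blast
  have "?K = down ` ?L \<union> sdown ` (?L - J)" using sdown_J by blast
  then have "card ?K = card (down ` ?L) + card (sdown ` (?L - J))"
    using disj finL by (simp add: card_Un_disjoint)
  also have "card (down ` ?L) = card ?L"
    unfolding down_def using inj_on_principal by (rule card_image)
  \<comment> \<open>Union is a left inverse of \<open>sdown\<close> outside
    \<open>J\<close>.\<close>
  also have "card (sdown ` (?L - J)) = card (?L - J)"
    using U by (intro card_image inj_on_inverseI)
  also have "\<dots> = card ?L - card Q"
    using J finL by (simp add: card_Diff_subset finite_subset)
  finally show ?thesis
    using dimS J card_mono[OF finL J(1)] by simp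
qed

section \<open>The rank of the lattice\<close>

text \<open>Ideals of \<open>Q\<close> without a maximal element \<open>m\<close> are still ideals
  of \<open>Q\<close>, so a chain for \<open>Q - {m}\<close> is extended by \<open>Q\<close> on
  top.\<close>

lemma exists_maximal_chain_order_ideals:
  fixes Q :: "'a::order set"
  assumes "finite Q"
  shows "\<exists>C \<subseteq> order_ideals Q. Complete_Partial_Order.chain (\<le>) C \<and> card C = card Q + 1"
  using assms
proof (induction Q rule: finite_psubset_induct)
  case (psubset Q)
  show ?case
  proof (cases "Q = {}")
    case True
    then show ?thesis
      by (intro exI[of _ "{{}}"]) (auto simp: order_ideals_def chain_def)
  next
    case False
    then obtain m where m: "m \<in> Q" "\<forall>y\<in>Q. m \<le> y \<longrightarrow> m = y"
      using finite_has_maximal psubset.hyps by blast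
    let ?Q = "Q - {m}"
    obtain C where C: "C \<subseteq> order_ideals ?Q" "Complete_Partial_Order.chain (\<le>) C"
        "card C = card ?Q + 1"
      using psubset.IH[of ?Q] m by blast
    have sub: "I \<subseteq> ?Q" if "I \<in> C" for I using that C(1) order_ideals_subset by blast
    have "order_ideals ?Q \<subseteq> order_ideals Q" using m unfolding order_ideals_def by blast
    then have "insert Q C \<subseteq> order_ideals Q" using C(1) by (auto simp: order_ideals_def)
    moreover have "Complete_Partial_Order.chain (\<le>) (insert Q C)"
      using C(2) sub unfolding chain_def by blast
    moreover have "card (insert Q C) = card Q + 1"
    proof -
      \<comment> \<open>An infinite set has \<open>card\<close> 0, whereas \<open>card C\<close> is
        a successor.\<close>
      have "finite C" using C(3) card.infinite by fastforce
      moreover have "Q \<notin> C" using sub[of Q] m(1) by blast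
      moreover have "card Q = card ?Q + 1"
        using card_Suc_Diff1[OF psubset.hyps m(1)] by linarith
      ultimately show ?thesis using C(3) by simp
    qed
    ultimately show ?thesis by blast
  qed
qed

lemma rk_order_ideals:
  fixes Q :: "'a::order set"
  assumes "finite Q"
  shows "rk (order_ideals Q) = card Q"
proof -
  let ?C = "{C. C \<subseteq> order_ideals Q \<and> Complete_Partial_Order.chain (\<le>) C}"
  have "card C \<le> card Q + 1" if C: "C \<in> ?C" for C
  proof -
    have sub: "I \<subseteq> Q" if "I \<in> C" for I
      using that C order_ideals_subset by blast
    have fin: "finite I" if "I \<in> C" for I
      using sub[OF that] assms by (rule finite_subset)
    \<comment> \<open>Comparable finite sets of equal size are equal, so a chain has at most one
      ideal of each size 0, ..., \<open>card Q\<close>; the resulting \<open>card Q + 1\<close> is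
      offset by the subtraction in \<open>rk\<close>.\<close>
    have "inj_on card C"
    proof (rule inj_onI)
      fix I J assume "I \<in> C" "J \<in> C" "card I = card J"
      moreover have "I \<subseteq> J \<or> J \<subseteq> I" using calculation C by (auto simp: chain_def)
      ultimately show "I = J" using fin card_subset_eq by metis
    qed
    moreover have "card ` C \<subseteq> {..card Q}" using sub assms by (auto intro: card_mono)
    ultimately show ?thesis using card_inj_on_le[of card C "{..card Q}"] by simp
  qed
  moreover have "finite ?C"
    using finite_order_ideals[OF assms] by (auto intro: finite_subset[of _ "Pow (order_ideals Q)"])
  moreover obtain C where "C \<in> ?C" "card C = card Q + 1"
    using exists_maximal_chain_order_ideals[OF assms] by blast
  then have "card Q + 1 \<in> card ` ?C" by (metis imageI)
  ultimately have "Max (card ` ?C) = card Q + 1"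
    by (intro Max_eqI) auto
  then show ?thesis by (simp add: rk_def)
qed

section \<open>The final dimension count\<close>

theorem theorem4p2:
  fixes Q :: "'a::order set" and P :: "'a set set"
  assumes "finite Q" and "width Q = 2"
    and "P = order_ideals Q"
  shows "dim (A_T P) = dim (I_T P) \<and> dim (I_T P) = rk P + 1"
proof -
  interpret finite_width_le_two Q
  proof
    fix A assume "A \<subseteq> Q" "antichain A"
    then have "card A \<le> width Q"
      unfolding width_def using assms(1) by (intro Max_ge) auto
    then show "card A \<le> 2" using assms(2) by simp
  qed (fact assms(1))
  let ?T = "{indicator (order_ideals P)} \<union> toggle P ` P"
  have fin: "finite P" using assms finite_order_ideals by simp
  have "dim (ideal_ind P ` P \<union> ?T) + card Q = 2 * card P"
    using span_ind_Un_toggle dim_span_ind_toggle_plus[OF assms(1)] unfolding assms(3)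
    by (metis dim_span)
  moreover have "dim (toggle_minus P ` P \<union> ?T) + card Q = 2 * card P"
    using span_toggle_minus_Un_toggle dim_span_ind_toggle_plus[OF assms(1)] unfolding assms(3)
    by (metis dim_span)
  moreover have "dim (I_T P) + dim (ideal_ind P ` P \<union> ?T) = card P + (card P + 1)"
    unfolding I_T_def using fin dim_ideal_ind[OF fin] dim_toggle[OF fin]
    by (subst dim_span_Int_span) simp_all
  moreover have "dim (A_T P) + dim (toggle_minus P ` P \<union> ?T) = card P + (card P + 1)"
    unfolding A_T_def using fin dim_toggle_minus[OF fin] dim_toggle[OF fin]
    by (subst dim_span_Int_span) simp_all
  \<comment> \<open>Both dimensions equal
    \<open>(2 * card P + 1) - (2 * card P - card Q) = card Q + 1\<close>.\<close>
  ultimately show ?thesis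
    using rk_order_ideals[OF assms(1)] assms(3) by simp
qed

end
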